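(* Let $\mathcal{K}$ be a 2-category, let $g\colon x\to y$ be a 1-cell of $\mathcal{K}$, $t$ a monad on $x$, and $s$ a $g$-determined monad on $y$. Suppose that the pushforward $g_\#t$ exists and that its counit $\varepsilon\colon(g_\#t)g\to gt$ is an isomorphism. Then the function sending $(g,\psi)\in\mathsf{Colax}_g(t,s)$ to the unique 2-cell $\widehat\psi\colon g_\#t\to s$ with $\widehat\psi g=\psi\cdot\varepsilon$ (which is a monad map) is a bijection $$\mathsf{Colax}_g(t,s)\cong\mathsf{Mnd}_y(g_\#t,s).$$
   Context: Notation: $\cdot$ is vertical and $*$ horizontal composition of 2-cells. A right extension of a 1-cell $k\colon x\to z$ along $g\colon x\to y$ is a pair $(r,\varepsilon)$ with $r\colon y\to z$ and $\varepsilon\colon rg\to k$ such that for every $r'\colon y\to z$ and $\alpha\colon r'g\to k$ there is a unique $\widehat\alpha\colon r'\to r$ with $\varepsilon\cdot\widehat\alpha g=\alpha$. Pushforward: for a monad $(t,\eta^t,\mu^t)$ on $x$ and $g\colon x\to y$, $g_\#t$ is, when it exists, the right extension $(g_\#t,\varepsilon)$ of $gt$ along $g$, with the unique monad structure such that $\varepsilon\cdot\eta^{g_\#t}g=g\eta^t$ and $\varepsilon\cdot\mu^{g_\#t}g=g\mu^t\cdot\varepsilon t\cdot(g_\#t)\varepsilon$; $\varepsilon$ is its counit. A 1-cell $h\colon y\to z$ is $g$-determined if $(h,1_{hg})$ is a right extension of $hg$ along $g$; a monad on $y$ is $g$-determined if its underlying 1-cell is. $\mathsf{Colax}_g(t,s)$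 is the collection of colax transformations with 1-cell part $g$: pairs $(g,\psi)$ with $\psi\colon gt\to sg$ such that $\psi\cdot g\eta^t=\eta^sg$ and $\psi\cdot g\mu^t=\mu^sg\cdot s\psi\cdot\psi t$. $\mathsf{Mnd}_y(s',s)$ is the collection of monad maps: 2-cells $\theta\colon s'\to s$ with $\theta\cdot\eta^{s'}=\eta^s$ and $\theta\cdot\mu^{s'}=\mu^s\cdot(\theta*\theta)$. *)

theory Defs
  imports Main
begin

section \<open>Strict 2-categories\<close>

text \<open>
  Both compositions are written in applicative order: \<open>g \<odot> f\<close> is \<open>g\<close> after \<open>f\<close>,
  \<open>\<beta> \<cdot> \<alpha>\<close> is \<open>\<beta>\<close> vertically after \<open>\<alpha>\<close>, and for \<open>\<alpha> : f \<Rightarrow> f'\<close> between 1-cells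
  \<open>x \<rightarrow> y\<close> and \<open>\<beta> : k \<Rightarrow> k'\<close> between 1-cells \<open>y \<rightarrow> z\<close>, the horizontal composite is
  \<open>\<beta> \<star> \<alpha> : k \<odot> f \<Rightarrow> k' \<odot> f'\<close>.  The whiskerings usually written \<open>\<beta>f\<close> and \<open>k\<alpha>\<close> are
  \<open>\<beta> \<star> \<iota> f\<close> and \<open>\<iota> k \<star> \<alpha>\<close>.  The operations are total functions; only their
  values on composable cells of the carriers matter.
\<close>

record ('o, 'm, 'c) two_cat =
  Obj :: "'o set"
  Arr :: "'m set"
  Cell :: "'c set"
  src :: "'m \<Rightarrow> 'o"
  tgt :: "'m \<Rightarrow> 'o"
  dom2 :: "'c \<Rightarrow> 'm"
  cod2 :: "'c \<Rightarrow> 'm"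
  id1 :: "'o \<Rightarrow> 'm"  (\<open>\<one>\<index> _\<close> [1000] 999)
  comp1 :: "'m \<Rightarrow> 'm \<Rightarrow> 'm"  (infixr \<open>\<odot>\<index>\<close> 80)
  id2 :: "'m \<Rightarrow> 'c"  (\<open>\<iota>\<index> _\<close> [1000] 999)
  vcomp :: "'c \<Rightarrow> 'c \<Rightarrow> 'c"  (infixr \<open>\<cdot>\<index>\<close> 70)
  hcomp :: "'c \<Rightarrow> 'c \<Rightarrow> 'c"  (infixr \<open>\<star>\<index>\<close> 75)

definition hom1 :: "('o, 'm, 'c, 'e) two_cat_scheme \<Rightarrow> 'o \<Rightarrow> 'o \<Rightarrow> 'm set"
  where "hom1 K x y = {f \<in> Arr K. src K f = x \<and> tgt K f = y}"

definition hom2 :: "('o, 'm, 'c, 'e) two_cat_scheme \<Rightarrow> 'm \<Rightarrow> 'm \<Rightarrow> 'c set"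
  where "hom2 K f g = {\<alpha> \<in> Cell K. dom2 K \<alpha> = f \<and> cod2 K \<alpha> = g}"

locale two_category =
  fixes K :: "('o, 'm, 'c, 'e) two_cat_scheme" (structure)
  assumes src_Obj: "f \<in> Arr K \<Longrightarrow> src K f \<in> Obj K"
    and tgt_Obj: "f \<in> Arr K \<Longrightarrow> tgt K f \<in> Obj K"
    and dom2_Arr: "\<alpha> \<in> Cell K \<Longrightarrow> dom2 K \<alpha> \<in> Arr K"
    and cod2_Arr: "\<alpha> \<in> Cell K \<Longrightarrow> cod2 K \<alpha> \<in> Arr K"
    and src_cod2: "\<alpha> \<in> Cell K \<Longrightarrow> src K (cod2 K \<alpha>) = src K (dom2 K \<alpha>)"
    and tgt_cod2: "\<alpha> \<in> Cell K \<Longrightarrow> tgt K (cod2 K \<alpha>) = tgt K (dom2 K \<alpha>)"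
    \<comment> \<open>the underlying category of objects and 1-cells\<close>
    and id1_hom: "x \<in> Obj K \<Longrightarrow> \<one> x \<in> hom1 K x x"
    and comp1_hom: "\<lbrakk>f \<in> hom1 K x y; g \<in> hom1 K y z\<rbrakk> \<Longrightarrow> g \<odot> f \<in> hom1 K x z"
    and comp1_assoc: "\<lbrakk>f \<in> hom1 K w x; g \<in> hom1 K x y; h \<in> hom1 K y z\<rbrakk>
      \<Longrightarrow> (h \<odot> g) \<odot> f = h \<odot> (g \<odot> f)"
    and comp1_id_right: "f \<in> hom1 K x y \<Longrightarrow> f \<odot> \<one> x = f"
    and comp1_id_left: "f \<in> hom1 K x y \<Longrightarrow> \<one> y \<odot> f = f"
    \<comment> \<open>the hom-categories\<close>
    and id2_hom: "f \<in> Arr K \<Longrightarrow> \<iota> f \<in> hom2 K f f"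
    and vcomp_hom: "\<lbrakk>\<alpha> \<in> hom2 K f g; \<beta> \<in> hom2 K g h\<rbrakk> \<Longrightarrow> \<beta> \<cdot> \<alpha> \<in> hom2 K f h"
    and vcomp_assoc: "\<lbrakk>\<alpha> \<in> hom2 K f g; \<beta> \<in> hom2 K g h; \<gamma> \<in> hom2 K h k\<rbrakk>
      \<Longrightarrow> (\<gamma> \<cdot> \<beta>) \<cdot> \<alpha> = \<gamma> \<cdot> (\<beta> \<cdot> \<alpha>)"
    and vcomp_id_right: "\<alpha> \<in> hom2 K f g \<Longrightarrow> \<alpha> \<cdot> \<iota> f = \<alpha>"
    and vcomp_id_left: "\<alpha> \<in> hom2 K f g \<Longrightarrow> \<iota> g \<cdot> \<alpha> = \<alpha>"
    \<comment> \<open>horizontal composition\<close>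
    and hcomp_hom: "\<lbrakk>f \<in> hom1 K x y; k \<in> hom1 K y z; \<alpha> \<in> hom2 K f f'; \<beta> \<in> hom2 K k k'\<rbrakk>
      \<Longrightarrow> \<beta> \<star> \<alpha> \<in> hom2 K (k \<odot> f) (k' \<odot> f')"
    and hcomp_assoc: "\<lbrakk>f \<in> hom1 K w x; g \<in> hom1 K x y; h \<in> hom1 K y z;
        \<alpha> \<in> hom2 K f f'; \<beta> \<in> hom2 K g g'; \<gamma> \<in> hom2 K h h'\<rbrakk>
      \<Longrightarrow> (\<gamma> \<star> \<beta>) \<star> \<alpha> = \<gamma> \<star> (\<beta> \<star> \<alpha>)"
    and hcomp_id_right: "\<lbrakk>f \<in> hom1 K x y; \<alpha> \<in> hom2 K f f'\<rbrakk> \<Longrightarrow> \<alpha> \<star> \<iota> (\<one> x) = \<alpha>"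
    and hcomp_id_left: "\<lbrakk>f \<in> hom1 K x y; \<alpha> \<in> hom2 K f f'\<rbrakk> \<Longrightarrow> \<iota> (\<one> y) \<star> \<alpha> = \<alpha>"
    and hcomp_id2: "\<lbrakk>f \<in> hom1 K x y; k \<in> hom1 K y z\<rbrakk> \<Longrightarrow> \<iota> k \<star> \<iota> f = \<iota> (k \<odot> f)"
    and interchange: "\<lbrakk>f \<in> hom1 K x y; k \<in> hom1 K y z;
        \<alpha> \<in> hom2 K f f'; \<alpha>' \<in> hom2 K f' f''; \<beta> \<in> hom2 K k k'; \<beta>' \<in> hom2 K k' k''\<rbrakk>
      \<Longrightarrow> (\<beta>' \<cdot> \<beta>) \<star> (\<alpha>' \<cdot> \<alpha>) = (\<beta>' \<star> \<alpha>') \<cdot> (\<beta> \<star> \<alpha>)"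

definition is_iso2 :: "('o, 'm, 'c, 'e) two_cat_scheme \<Rightarrow> 'm \<Rightarrow> 'm \<Rightarrow> 'c \<Rightarrow> bool"
  where "is_iso2 K f g \<alpha> \<longleftrightarrow> \<alpha> \<in> hom2 K f g \<and>
    (\<exists>\<beta> \<in> hom2 K g f. \<beta> \<cdot>\<^bsub>K\<^esub> \<alpha> = \<iota>\<^bsub>K\<^esub> f \<and> \<alpha> \<cdot>\<^bsub>K\<^esub> \<beta> = \<iota>\<^bsub>K\<^esub> g)"


section \<open>Right extensions\<close>

text \<open>\<open>(r, \<epsilon>)\<close> is a right extension of \<open>k : x \<rightarrow> z\<close> along \<open>g : x \<rightarrow> y\<close>.\<close>

definition is_right_extension ::
  "('o, 'm, 'c, 'e) two_cat_scheme \<Rightarrow> 'o \<Rightarrow> 'o \<Rightarrow> 'o \<Rightarrow> 'm \<Rightarrow> 'm \<Rightarrow> 'm \<Rightarrow> 'c \<Rightarrow> bool"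
  where "is_right_extension K x y z k g r \<epsilon> \<longleftrightarrow>
    k \<in> hom1 K x z \<and> g \<in> hom1 K x y \<and> r \<in> hom1 K y z \<and>
    \<epsilon> \<in> hom2 K (r \<odot>\<^bsub>K\<^esub> g) k \<and>
    (\<forall>r' \<in> hom1 K y z. \<forall>\<alpha> \<in> hom2 K (r' \<odot>\<^bsub>K\<^esub> g) k.
      \<exists>!\<alpha>'. \<alpha>' \<in> hom2 K r' r \<and> \<epsilon> \<cdot>\<^bsub>K\<^esub> (\<alpha>' \<star>\<^bsub>K\<^esub> \<iota>\<^bsub>K\<^esub> g) = \<alpha>)"

definition determined ::
  "('o, 'm, 'c, 'e) two_cat_scheme \<Rightarrow> 'o \<Rightarrow> 'o \<Rightarrow> 'o \<Rightarrow> 'm \<Rightarrow> 'm \<Rightarrow> bool"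
  where "determined K x y z g h \<longleftrightarrow>
    is_right_extension K x y z (h \<odot>\<^bsub>K\<^esub> g) g h (\<iota>\<^bsub>K\<^esub> (h \<odot>\<^bsub>K\<^esub> g))"


section \<open>Monads, monad maps and colax transformations\<close>

record ('m, 'c) monad =
  mcell :: 'm
  munit :: 'c
  mmult :: 'c

definition is_monad ::
  "('o, 'm, 'c, 'e) two_cat_scheme \<Rightarrow> 'o \<Rightarrow> ('m, 'c) monad \<Rightarrow> bool"
  where "is_monad K x t \<longleftrightarrow>
    x \<in> Obj K \<and>
    mcell t \<in> hom1 K x x \<and>
    munit t \<in> hom2 K (\<one>\<^bsub>K\<^esub> x) (mcell t) \<and>
    mmult t \<in> hom2 K (mcell t \<odot>\<^bsub>K\<^esub> mcell t) (mcell t) \<and>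
    mmult t \<cdot>\<^bsub>K\<^esub> (munit t \<star>\<^bsub>K\<^esub> \<iota>\<^bsub>K\<^esub> (mcell t)) = \<iota>\<^bsub>K\<^esub> (mcell t) \<and>
    mmult t \<cdot>\<^bsub>K\<^esub> (\<iota>\<^bsub>K\<^esub> (mcell t) \<star>\<^bsub>K\<^esub> munit t) = \<iota>\<^bsub>K\<^esub> (mcell t) \<and>
    mmult t \<cdot>\<^bsub>K\<^esub> (mmult t \<star>\<^bsub>K\<^esub> \<iota>\<^bsub>K\<^esub> (mcell t)) =
      mmult t \<cdot>\<^bsub>K\<^esub> (\<iota>\<^bsub>K\<^esub> (mcell t) \<star>\<^bsub>K\<^esub> mmult t)"

definition Mnd ::
  "('o, 'm, 'c, 'e) two_cat_scheme \<Rightarrow> ('m, 'c) monad \<Rightarrow> ('m, 'c) monad \<Rightarrow> 'c set"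
  where "Mnd K s' s = {\<theta> \<in> hom2 K (mcell s') (mcell s).
    \<theta> \<cdot>\<^bsub>K\<^esub> munit s' = munit s \<and>
    \<theta> \<cdot>\<^bsub>K\<^esub> mmult s' = mmult s \<cdot>\<^bsub>K\<^esub> (\<theta> \<star>\<^bsub>K\<^esub> \<theta>)}"

definition Colax ::
  "('o, 'm, 'c, 'e) two_cat_scheme \<Rightarrow> 'm \<Rightarrow> ('m, 'c) monad \<Rightarrow> ('m, 'c) monad \<Rightarrow> ('m \<times> 'c) set"
  where "Colax K g t s = {(h, \<psi>). h = g \<and>
    \<psi> \<in> hom2 K (g \<odot>\<^bsub>K\<^esub> mcell t) (mcell s \<odot>\<^bsub>K\<^esub> g) \<and>
    \<psi> \<cdot>\<^bsub>K\<^esub> (\<iota>\<^bsub>K\<^esub> g \<star>\<^bsub>K\<^esub> munit t) = munit s \<star>\<^bsub>K\<^esub> \<iota>\<^bsub>K\<^esub> g \<and>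
    \<psi> \<cdot>\<^bsub>K\<^esub> (\<iota>\<^bsub>K\<^esub> g \<star>\<^bsub>K\<^esub> mmult t) =
      (mmult s \<star>\<^bsub>K\<^esub> \<iota>\<^bsub>K\<^esub> g) \<cdot>\<^bsub>K\<^esub> (\<iota>\<^bsub>K\<^esub> (mcell s) \<star>\<^bsub>K\<^esub> \<psi>) \<cdot>\<^bsub>K\<^esub> (\<psi> \<star>\<^bsub>K\<^esub> \<iota>\<^bsub>K\<^esub> (mcell t))}"


section \<open>Pushforward of a monad\<close>

definition is_pushforward ::
  "('o, 'm, 'c, 'e) two_cat_scheme \<Rightarrow> 'o \<Rightarrow> 'o \<Rightarrow> 'm \<Rightarrow> ('m, 'c) monad \<Rightarrow> ('m, 'c) monad \<Rightarrow> 'c \<Rightarrow> bool"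
  where "is_pushforward K x y g t p \<epsilon> \<longleftrightarrow>
    is_right_extension K x y y (g \<odot>\<^bsub>K\<^esub> mcell t) g (mcell p) \<epsilon> \<and>
    is_monad K y p \<and>
    \<epsilon> \<cdot>\<^bsub>K\<^esub> (munit p \<star>\<^bsub>K\<^esub> \<iota>\<^bsub>K\<^esub> g) = \<iota>\<^bsub>K\<^esub> g \<star>\<^bsub>K\<^esub> munit t \<and>
    \<epsilon> \<cdot>\<^bsub>K\<^esub> (mmult p \<star>\<^bsub>K\<^esub> \<iota>\<^bsub>K\<^esub> g) =
      (\<iota>\<^bsub>K\<^esub> g \<star>\<^bsub>K\<^esub> mmult t) \<cdot>\<^bsub>K\<^esub> (\<epsilon> \<star>\<^bsub>K\<^esub> \<iota>\<^bsub>K\<^esub> (mcell t)) \<cdot>\<^bsub>K\<^esub> (\<iota>\<^bsub>K\<^esub> (mcell p) \<star>\<^bsub>K\<^esub> \<epsilon>)"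


text \<open>
  The predicate \<open>is_pushforward\<close> demands nothing beyond the existence of the right
  extension: the monad structure on it exists and is unique.
\<close>

context two_category
begin

lemma hom1_Arr: "f \<in> hom1 K x y \<Longrightarrow> f \<in> Arr K"
  by (simp add: hom1_def)

lemma hom2_cod_hom1: "\<lbrakk>\<alpha> \<in> hom2 K f f'; f \<in> hom1 K x y\<rbrakk> \<Longrightarrow> f' \<in> hom1 K x y"
  using cod2_Arr src_cod2 tgt_cod2 by (auto simp: hom1_def hom2_def)

lemma id2_hom1: "f \<in> hom1 K x y \<Longrightarrow> \<iota> f \<in> hom2 K f f"
  by (simp add: hom1_Arr id2_hom)

lemma whisker_right_vcomp:
  assumes "f \<in> hom1 K x y" "k \<in> hom1 K y z" "\<beta> \<in> hom2 K k k'" "\<beta>' \<in> hom2 K k' k''"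
  shows "(\<beta>' \<cdot> \<beta>) \<star> \<iota> f = (\<beta>' \<star> \<iota> f) \<cdot> (\<beta> \<star> \<iota> f)"
  using interchange[OF assms(1,2) id2_hom1[OF assms(1)] id2_hom1[OF assms(1)] assms(3,4)]
    vcomp_id_left[OF id2_hom1[OF assms(1)]] by simp

lemma whisker_left_vcomp:
  assumes "f \<in> hom1 K x y" "k \<in> hom1 K y z" "\<alpha> \<in> hom2 K f f'" "\<alpha>' \<in> hom2 K f' f''"
  shows "\<iota> k \<star> (\<alpha>' \<cdot> \<alpha>) = (\<iota> k \<star> \<alpha>') \<cdot> (\<iota> k \<star> \<alpha>)"
  using interchange[OF assms(1,2) assms(3,4) id2_hom1[OF assms(2)] id2_hom1[OF assms(2)]]
    vcomp_id_left[OF id2_hom1[OF assms(2)]] by simp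

lemma whisker_swap:
  assumes f: "f \<in> hom1 K x y" and k: "k \<in> hom1 K y z"
    and a: "\<alpha> \<in> hom2 K f f'" and b: "\<beta> \<in> hom2 K k k'"
  shows "(\<iota> k' \<star> \<alpha>) \<cdot> (\<beta> \<star> \<iota> f) = (\<beta> \<star> \<iota> f') \<cdot> (\<iota> k \<star> \<alpha>)"
proof -
  have f': "f' \<in> hom1 K x y" and k': "k' \<in> hom1 K y z"
    using a b f k hom2_cod_hom1 by auto
  have "(\<iota> k' \<star> \<alpha>) \<cdot> (\<beta> \<star> \<iota> f) = (\<iota> k' \<cdot> \<beta>) \<star> (\<alpha> \<cdot> \<iota> f)"
    using interchange[OF f k id2_hom1[OF f] a b id2_hom1[OF k']] by simp
  also have "\<dots> = (\<beta> \<cdot> \<iota> k) \<star> (\<iota> f' \<cdot> \<alpha>)"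
    using vcomp_id_left[OF a] vcomp_id_left[OF b] vcomp_id_right[OF a] vcomp_id_right[OF b]
    by simp
  also have "\<dots> = (\<beta> \<star> \<iota> f') \<cdot> (\<iota> k \<star> \<alpha>)"
    using interchange[OF f k a id2_hom1[OF f'] id2_hom1[OF k] b] by simp
  finally show ?thesis .
qed

lemma ex1_pushforward:
  assumes t: "is_monad K x t"
    and ext: "is_right_extension K x y y (g \<odot> mcell t) g r \<epsilon>"
  shows "\<exists>!p. mcell p = r \<and> is_pushforward K x y g t p \<epsilon>"
proof -
  define T e h u where "T = mcell t" and "e = munit t" and "h = mmult t" and "u = g \<odot> T"
  have x: "x \<in> Obj K" and T: "T \<in> hom1 K x x" and e: "e \<in> hom2 K (\<one> x) T"
    and h: "h \<in> hom2 K (T \<odot> T) T"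
    and hl: "h \<cdot> (e \<star> \<iota> T) = \<iota> T" and hr: "h \<cdot> (\<iota> T \<star> e) = \<iota> T"
    and ha: "h \<cdot> (h \<star> \<iota> T) = h \<cdot> (\<iota> T \<star> h)"
    using t by (auto simp: is_monad_def T_def e_def h_def)
  have g: "g \<in> hom1 K x y" and r: "r \<in> hom1 K y y" and u: "u \<in> hom1 K x y"
    and E: "\<epsilon> \<in> hom2 K (r \<odot> g) u"
    and univ: "\<And>r' \<alpha>. \<lbrakk>r' \<in> hom1 K y y; \<alpha> \<in> hom2 K (r' \<odot> g) u\<rbrakk> \<Longrightarrow>
      \<exists>!\<alpha>'. \<alpha>' \<in> hom2 K r' r \<and> \<epsilon> \<cdot> (\<alpha>' \<star> \<iota> g) = \<alpha>"
    using ext by (auto simp: is_right_extension_def T_def u_def)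
  have y: "y \<in> Obj K" using g tgt_Obj by (auto simp: hom1_def)
  note Ix = id1_hom[OF x] and Iy = id1_hom[OF y]
  note c1 = comp1_hom
  have rg: "r \<odot> g \<in> hom1 K x y" and rr: "r \<odot> r \<in> hom1 K y y" and TT: "T \<odot> T \<in> hom1 K x x"
    and ru: "r \<odot> u \<in> hom1 K x y" and uT: "u \<odot> T \<in> hom1 K x y"
    using g r T u c1 by blast+
  have eqv: "a = b"
    if "r' \<in> hom1 K y y" "a \<in> hom2 K r' r" "b \<in> hom2 K r' r"
      "\<epsilon> \<cdot> (a \<star> \<iota> g) = \<epsilon> \<cdot> (b \<star> \<iota> g)" for r' a b
  proof -
    have "\<epsilon> \<cdot> (b \<star> \<iota> g) \<in> hom2 K (r' \<odot> g) u"
      using vcomp_hom[OF hcomp_hom[OF g that(1) id2_hom1[OF g] that(3)] E] .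
    from univ[OF that(1) this] that show ?thesis by blast
  qed
  note i = id2_hom1
  have ge: "\<iota> g \<star> e \<in> hom2 K g u"
    using hcomp_hom[OF Ix g e i[OF g]] comp1_id_right[OF g] by (simp add: u_def)
  have gh: "\<iota> g \<star> h \<in> hom2 K (u \<odot> T) u"
    using hcomp_hom[OF TT g h i[OF g]] comp1_assoc[OF T T g] by (simp add: u_def)
  have eT: "\<epsilon> \<star> \<iota> T \<in> hom2 K (r \<odot> u) (u \<odot> T)"
    using hcomp_hom[OF T rg i[OF T] E] comp1_assoc[OF T g r] by (simp add: u_def)
  have re: "\<iota> r \<star> \<epsilon> \<in> hom2 K (r \<odot> r \<odot> g) (r \<odot> u)"
    using hcomp_hom[OF rg r E i[OF r]] .
  define w where "w = (\<iota> g \<star> h) \<cdot> (\<epsilon> \<star> \<iota> T) \<cdot> (\<iota> r \<star> \<epsilon>)"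
  have w: "w \<in> hom2 K ((r \<odot> r) \<odot> g) u"
    using vcomp_hom[OF vcomp_hom[OF re eT] gh] comp1_assoc[OF g r r] by (simp add: w_def)
  have ge': "\<iota> g \<star> e \<in> hom2 K (\<one> y \<odot> g) u"
    using ge comp1_id_left[OF g] by simp
  obtain n where n: "n \<in> hom2 K (\<one> y) r" and ne: "\<epsilon> \<cdot> (n \<star> \<iota> g) = \<iota> g \<star> e"
    using univ[OF Iy ge'] by blast
  obtain m where m: "m \<in> hom2 K (r \<odot> r) r" and me: "\<epsilon> \<cdot> (m \<star> \<iota> g) = w"
    using univ[OF rr w] by blast
  have ng: "n \<star> \<iota> g \<in> hom2 K g (r \<odot> g)"
    using hcomp_hom[OF g Iy i[OF g] n] comp1_id_left[OF g] by simp
  have mg: "m \<star> \<iota> g \<in> hom2 K (r \<odot> r \<odot> g) (r \<odot> g)"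
    using hcomp_hom[OF g rr i[OF g] m] comp1_assoc[OF g r r] by simp
  have step: "\<epsilon> \<cdot> ((m \<cdot> v) \<star> \<iota> g) = (\<iota> g \<star> h) \<cdot> (\<epsilon> \<star> \<iota> T) \<cdot> (\<iota> r \<star> \<epsilon>) \<cdot> (v \<star> \<iota> g)"
    if q: "q \<in> hom1 K y y" and v: "v \<in> hom2 K q (r \<odot> r)" for q v
  proof -
    have vg: "v \<star> \<iota> g \<in> hom2 K (q \<odot> g) (r \<odot> r \<odot> g)"
      using hcomp_hom[OF g q i[OF g] v] comp1_assoc[OF g r r] by simp
    have "\<epsilon> \<cdot> ((m \<cdot> v) \<star> \<iota> g) = \<epsilon> \<cdot> (m \<star> \<iota> g) \<cdot> (v \<star> \<iota> g)"
      using whisker_right_vcomp[OF g q v m] by simp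
    also have "\<dots> = w \<cdot> (v \<star> \<iota> g)"
      using vcomp_assoc[OF vg mg E] me by simp
    also have "\<dots> = (\<iota> g \<star> h) \<cdot> ((\<epsilon> \<star> \<iota> T) \<cdot> (\<iota> r \<star> \<epsilon>)) \<cdot> (v \<star> \<iota> g)"
      using vcomp_assoc[OF vg vcomp_hom[OF re eT] gh] by (simp add: w_def)
    also have "\<dots> = (\<iota> g \<star> h) \<cdot> (\<epsilon> \<star> \<iota> T) \<cdot> (\<iota> r \<star> \<epsilon>) \<cdot> (v \<star> \<iota> g)"
      using vcomp_assoc[OF vg re eT] by simp
    finally show ?thesis .
  qed
  have nr: "n \<star> \<iota> r \<in> hom2 K r (r \<odot> r)"
    using hcomp_hom[OF r Iy i[OF r] n] comp1_id_left[OF r] by simp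
  have rn: "\<iota> r \<star> n \<in> hom2 K r (r \<odot> r)"
    using hcomp_hom[OF Iy r n i[OF r]] comp1_id_right[OF r] by simp
  have rg2: "\<epsilon> \<cdot> (\<iota> r \<star> \<iota> g) = \<epsilon>"
    using hcomp_id2[OF g r] vcomp_id_right[OF E] by simp
  have left_unit: "m \<cdot> (n \<star> \<iota> r) = \<iota> r"
  proof (rule eqv[OF r vcomp_hom[OF nr m] i[OF r]])
    have nu: "n \<star> \<iota> u \<in> hom2 K u (r \<odot> u)"
      using hcomp_hom[OF u Iy i[OF u] n] comp1_id_left[OF u] by simp
    have nu': "n \<star> \<iota> u = (n \<star> \<iota> g) \<star> \<iota> T"
      using hcomp_assoc[OF T g Iy i[OF T] i[OF g] n] hcomp_id2[OF T g] by (simp add: u_def)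
    have A: "(\<iota> r \<star> \<epsilon>) \<cdot> ((n \<star> \<iota> r) \<star> \<iota> g) = (n \<star> \<iota> u) \<cdot> \<epsilon>"
      using whisker_swap[OF rg Iy E n] hcomp_assoc[OF g r Iy i[OF g] i[OF r] n]
        hcomp_id2[OF g r] hcomp_id_left[OF rg E] by simp
    have B: "(\<epsilon> \<star> \<iota> T) \<cdot> (n \<star> \<iota> u) = \<iota> g \<star> (e \<star> \<iota> T)"
      using whisker_right_vcomp[OF T g ng E] ne
        hcomp_assoc[OF T Ix g i[OF T] e i[OF g]] by (simp add: nu')
    have eT': "e \<star> \<iota> T \<in> hom2 K T (T \<odot> T)"
      using hcomp_hom[OF T Ix i[OF T] e] comp1_id_left[OF T] by simp
    have C: "(\<iota> g \<star> h) \<cdot> (\<iota> g \<star> (e \<star> \<iota> T)) = \<iota> u"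
      using whisker_left_vcomp[OF T g eT' h] hl hcomp_id2[OF T g] by (simp add: u_def)
    have "\<epsilon> \<cdot> ((m \<cdot> (n \<star> \<iota> r)) \<star> \<iota> g) = (\<iota> g \<star> h) \<cdot> (\<epsilon> \<star> \<iota> T) \<cdot> (n \<star> \<iota> u) \<cdot> \<epsilon>"
      using step[OF r nr] A by simp
    also have "\<dots> = (\<iota> g \<star> h) \<cdot> ((\<epsilon> \<star> \<iota> T) \<cdot> (n \<star> \<iota> u)) \<cdot> \<epsilon>"
      using vcomp_assoc[OF E nu eT] by simp
    also have "\<dots> = ((\<iota> g \<star> h) \<cdot> (\<epsilon> \<star> \<iota> T) \<cdot> (n \<star> \<iota> u)) \<cdot> \<epsilon>"
      using vcomp_assoc[OF E vcomp_hom[OF nu eT] gh] by simp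
    also have "\<dots> = \<epsilon>" using B C vcomp_id_left[OF E] by simp
    finally show "\<epsilon> \<cdot> ((m \<cdot> (n \<star> \<iota> r)) \<star> \<iota> g) = \<epsilon> \<cdot> (\<iota> r \<star> \<iota> g)"
      using rg2 by simp
  qed
  have right_unit: "m \<cdot> (\<iota> r \<star> n) = \<iota> r"
  proof (rule eqv[OF r vcomp_hom[OF rn m] i[OF r]])
    have A: "(\<iota> r \<star> \<epsilon>) \<cdot> ((\<iota> r \<star> n) \<star> \<iota> g) = \<iota> (r \<odot> g) \<star> e"
      using hcomp_assoc[OF g Iy r i[OF g] n i[OF r]] whisker_left_vcomp[OF g r ng E] ne
        hcomp_assoc[OF Ix g r e i[OF g] i[OF r]] hcomp_id2[OF g r] by simp
    have ue: "\<iota> u \<star> e \<in> hom2 K u (u \<odot> T)"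
      using hcomp_hom[OF Ix u e i[OF u]] comp1_id_right[OF u] by simp
    have B: "(\<epsilon> \<star> \<iota> T) \<cdot> (\<iota> (r \<odot> g) \<star> e) = (\<iota> u \<star> e) \<cdot> \<epsilon>"
      using whisker_swap[OF Ix rg e E] hcomp_id_right[OF rg E] by simp
    have ue': "\<iota> u \<star> e = \<iota> g \<star> (\<iota> T \<star> e)"
      using hcomp_assoc[OF Ix T g e i[OF T] i[OF g]] hcomp_id2[OF T g] by (simp add: u_def)
    have Te: "\<iota> T \<star> e \<in> hom2 K T (T \<odot> T)"
      using hcomp_hom[OF Ix T e i[OF T]] comp1_id_right[OF T] by simp
    have C: "(\<iota> g \<star> h) \<cdot> (\<iota> u \<star> e) = \<iota> u"
      using whisker_left_vcomp[OF T g Te h] hr hcomp_id2[OF T g] ue' by (simp add: u_def)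
    have "\<epsilon> \<cdot> ((m \<cdot> (\<iota> r \<star> n)) \<star> \<iota> g) = (\<iota> g \<star> h) \<cdot> (\<iota> u \<star> e) \<cdot> \<epsilon>"
      using step[OF r rn] A B by simp
    also have "\<dots> = \<epsilon>" using vcomp_assoc[OF E ue gh] C vcomp_id_left[OF E] by simp
    finally show "\<epsilon> \<cdot> ((m \<cdot> (\<iota> r \<star> n)) \<star> \<iota> g) = \<epsilon> \<cdot> (\<iota> r \<star> \<iota> g)"
      using rg2 by simp
  qed
  have rrr: "r \<odot> r \<odot> r \<in> hom1 K y y" using c1 r rr by blast
  have mr: "m \<star> \<iota> r \<in> hom2 K (r \<odot> r \<odot> r) (r \<odot> r)"
    using hcomp_hom[OF r rr i[OF r] m] comp1_assoc[OF r r r] by simp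
  have rm: "\<iota> r \<star> m \<in> hom2 K (r \<odot> r \<odot> r) (r \<odot> r)"
    using hcomp_hom[OF rr r m i[OF r]] .
  have assoc: "m \<cdot> (m \<star> \<iota> r) = m \<cdot> (\<iota> r \<star> m)"
  proof (rule eqv[OF rrr vcomp_hom[OF mr m] vcomp_hom[OF rm m]])
    have uTT: "u \<odot> T \<odot> T \<in> hom1 K x y" using c1 u TT by blast
    have rrg: "r \<odot> r \<odot> g \<in> hom1 K x y" using c1 rg r by blast
    let ?rre = "\<iota> r \<star> (\<iota> r \<star> \<epsilon>)" and ?reT = "\<iota> r \<star> (\<epsilon> \<star> \<iota> T)" and ?eTT = "\<epsilon> \<star> \<iota> (T \<odot> T)"
    have rre: "?rre \<in> hom2 K (r \<odot> r \<odot> r \<odot> g) (r \<odot> r \<odot> u)"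
      using hcomp_hom[OF rrg r re i[OF r]] .
    have reT: "?reT \<in> hom2 K (r \<odot> r \<odot> u) (r \<odot> u \<odot> T)"
      using hcomp_hom[OF ru r eT i[OF r]] .
    have eTT: "?eTT \<in> hom2 K (r \<odot> u \<odot> T) (u \<odot> T \<odot> T)"
      using hcomp_hom[OF TT rg i[OF TT] E] comp1_assoc[OF TT g r] comp1_assoc[OF T T g]
      by (simp add: u_def)
    have ghT: "(\<iota> g \<star> h) \<star> \<iota> T \<in> hom2 K (u \<odot> T \<odot> T) (u \<odot> T)"
      using hcomp_hom[OF T uT i[OF T] gh] comp1_assoc[OF T T u] by simp
    have uh: "\<iota> u \<star> h \<in> hom2 K (u \<odot> T \<odot> T) (u \<odot> T)"
      using hcomp_hom[OF TT u h i[OF u]] .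
    have mu: "m \<star> \<iota> u \<in> hom2 K (r \<odot> r \<odot> u) (r \<odot> u)"
      using hcomp_hom[OF u rr i[OF u] m] comp1_assoc[OF u r r] by simp
    have rgh: "\<iota> r \<star> (\<iota> g \<star> h) \<in> hom2 K (r \<odot> u \<odot> T) (r \<odot> u)"
      using hcomp_hom[OF uT r gh i[OF r]] .
    have A: "(\<iota> r \<star> \<epsilon>) \<cdot> ((m \<star> \<iota> r) \<star> \<iota> g) = (m \<star> \<iota> u) \<cdot> ?rre"
      using whisker_swap[OF rg rr E m] hcomp_assoc[OF g r rr i[OF g] i[OF r] m]
        hcomp_id2[OF g r] hcomp_assoc[OF rg r r E i[OF r] i[OF r]] hcomp_id2[OF r r] by simp
    have muT: "m \<star> \<iota> u = (m \<star> \<iota> g) \<star> \<iota> T"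
      using hcomp_assoc[OF T g rr i[OF T] i[OF g] m] hcomp_id2[OF T g] by (simp add: u_def)
    have "(\<epsilon> \<star> \<iota> T) \<cdot> (m \<star> \<iota> u) = w \<star> \<iota> T"
      using whisker_right_vcomp[OF T rrg mg E] me muT by simp
    also have "\<dots> = ((\<iota> g \<star> h) \<star> \<iota> T) \<cdot> (((\<epsilon> \<star> \<iota> T) \<cdot> (\<iota> r \<star> \<epsilon>)) \<star> \<iota> T)"
      using whisker_right_vcomp[OF T rrg vcomp_hom[OF re eT] gh] by (simp add: w_def)
    also have "\<dots> = ((\<iota> g \<star> h) \<star> \<iota> T) \<cdot> ((\<epsilon> \<star> \<iota> T) \<star> \<iota> T) \<cdot> ((\<iota> r \<star> \<epsilon>) \<star> \<iota> T)"
      using whisker_right_vcomp[OF T rrg re eT] by simp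
    also have "\<dots> = ((\<iota> g \<star> h) \<star> \<iota> T) \<cdot> ?eTT \<cdot> ?reT"
      using hcomp_assoc[OF T T rg i[OF T] i[OF T] E] hcomp_id2[OF T T]
        hcomp_assoc[OF T rg r i[OF T] E i[OF r]] by simp
    finally have B: "(\<epsilon> \<star> \<iota> T) \<cdot> (m \<star> \<iota> u) = ((\<iota> g \<star> h) \<star> \<iota> T) \<cdot> ?eTT \<cdot> ?reT" .
    have "\<epsilon> \<cdot> ((m \<cdot> (m \<star> \<iota> r)) \<star> \<iota> g) = (\<iota> g \<star> h) \<cdot> (\<epsilon> \<star> \<iota> T) \<cdot> (m \<star> \<iota> u) \<cdot> ?rre"
      using step[OF rrr mr] A by simp
    also have "\<dots> = (\<iota> g \<star> h) \<cdot> (((\<iota> g \<star> h) \<star> \<iota> T) \<cdot> ?eTT \<cdot> ?reT) \<cdot> ?rre"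
      using vcomp_assoc[OF rre mu eT] B by simp
    also have "\<dots> = (\<iota> g \<star> h) \<cdot> ((\<iota> g \<star> h) \<star> \<iota> T) \<cdot> ?eTT \<cdot> ?reT \<cdot> ?rre"
      using vcomp_assoc[OF rre vcomp_hom[OF reT eTT] ghT] vcomp_assoc[OF rre reT eTT] by simp
    also have "\<dots> = ((\<iota> g \<star> h) \<cdot> ((\<iota> g \<star> h) \<star> \<iota> T)) \<cdot> ?eTT \<cdot> ?reT \<cdot> ?rre"
      using vcomp_assoc[OF vcomp_hom[OF vcomp_hom[OF rre reT] eTT] ghT gh] by simp
    finally have L: "\<epsilon> \<cdot> ((m \<cdot> (m \<star> \<iota> r)) \<star> \<iota> g) =
      ((\<iota> g \<star> h) \<cdot> ((\<iota> g \<star> h) \<star> \<iota> T)) \<cdot> ?eTT \<cdot> ?reT \<cdot> ?rre" .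
    have hT: "h \<star> \<iota> T \<in> hom2 K (T \<odot> T \<odot> T) (T \<odot> T)"
      using hcomp_hom[OF T TT i[OF T] h] comp1_assoc[OF T T T] by simp
    have Th: "\<iota> T \<star> h \<in> hom2 K (T \<odot> T \<odot> T) (T \<odot> T)"
      using hcomp_hom[OF TT T h i[OF T]] .
    have TTT: "T \<odot> T \<odot> T \<in> hom1 K x x" using c1 T TT by blast
    have uh': "\<iota> u \<star> h = \<iota> g \<star> (\<iota> T \<star> h)"
      using hcomp_assoc[OF TT T g h i[OF T] i[OF g]] hcomp_id2[OF T g] by (simp add: u_def)
    have M: "(\<iota> g \<star> h) \<cdot> ((\<iota> g \<star> h) \<star> \<iota> T) = (\<iota> g \<star> h) \<cdot> (\<iota> u \<star> h)"
      using whisker_left_vcomp[OF TTT g hT h] whisker_left_vcomp[OF TTT g Th h] ha uh'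
        hcomp_assoc[OF T TT g i[OF T] h i[OF g]] by simp
    have "(\<iota> r \<star> \<epsilon>) \<cdot> ((\<iota> r \<star> m) \<star> \<iota> g) = \<iota> r \<star> w"
      using hcomp_assoc[OF g rr r i[OF g] m i[OF r]] whisker_left_vcomp[OF rrg r mg E] me by simp
    also have "\<dots> = (\<iota> r \<star> (\<iota> g \<star> h)) \<cdot> ?reT \<cdot> ?rre"
      using whisker_left_vcomp[OF rrg r vcomp_hom[OF re eT] gh]
        whisker_left_vcomp[OF rrg r re eT] by (simp add: w_def)
    finally have D: "(\<iota> r \<star> \<epsilon>) \<cdot> ((\<iota> r \<star> m) \<star> \<iota> g) = (\<iota> r \<star> (\<iota> g \<star> h)) \<cdot> ?reT \<cdot> ?rre" .
    have F: "(\<epsilon> \<star> \<iota> T) \<cdot> (\<iota> r \<star> (\<iota> g \<star> h)) = (\<iota> u \<star> h) \<cdot> ?eTT"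
      using whisker_swap[OF TT rg h E] hcomp_assoc[OF TT g r h i[OF g] i[OF r]]
        hcomp_id2[OF g r] by simp
    have "\<epsilon> \<cdot> ((m \<cdot> (\<iota> r \<star> m)) \<star> \<iota> g) =
      (\<iota> g \<star> h) \<cdot> (\<epsilon> \<star> \<iota> T) \<cdot> (\<iota> r \<star> (\<iota> g \<star> h)) \<cdot> ?reT \<cdot> ?rre"
      using step[OF rrr rm] D by simp
    also have "\<dots> = (\<iota> g \<star> h) \<cdot> ((\<iota> u \<star> h) \<cdot> ?eTT) \<cdot> ?reT \<cdot> ?rre"
      using vcomp_assoc[OF vcomp_hom[OF rre reT] rgh eT] F by simp
    also have "\<dots> = (\<iota> g \<star> h) \<cdot> (\<iota> u \<star> h) \<cdot> ?eTT \<cdot> ?reT \<cdot> ?rre"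
      using vcomp_assoc[OF vcomp_hom[OF rre reT] eTT uh] by simp
    also have "\<dots> = ((\<iota> g \<star> h) \<cdot> (\<iota> u \<star> h)) \<cdot> ?eTT \<cdot> ?reT \<cdot> ?rre"
      using vcomp_assoc[OF vcomp_hom[OF vcomp_hom[OF rre reT] eTT] uh gh] by simp
    finally show "\<epsilon> \<cdot> ((m \<cdot> (m \<star> \<iota> r)) \<star> \<iota> g) = \<epsilon> \<cdot> ((m \<cdot> (\<iota> r \<star> m)) \<star> \<iota> g)"
      using L M by simp
  qed
  let ?p = "\<lparr>mcell = r, munit = n, mmult = m\<rparr>"
  show ?thesis
  proof (rule ex1I[of _ ?p])
    show "mcell ?p = r \<and> is_pushforward K x y g t ?p \<epsilon>"
      using ext y r n m left_unit right_unit assoc ne me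
      by (simp add: is_pushforward_def is_monad_def w_def T_def e_def h_def)
  next
    fix p
    assume p: "mcell p = r \<and> is_pushforward K x y g t p \<epsilon>"
    then have "munit p \<in> hom2 K (\<one> y) r" "mmult p \<in> hom2 K (r \<odot> r) r"
      "\<epsilon> \<cdot> (munit p \<star> \<iota> g) = \<epsilon> \<cdot> (n \<star> \<iota> g)" "\<epsilon> \<cdot> (mmult p \<star> \<iota> g) = \<epsilon> \<cdot> (m \<star> \<iota> g)"
      using ne me by (auto simp: is_pushforward_def is_monad_def w_def T_def e_def h_def)
    then have "munit p = n" "mmult p = m"
      using eqv[OF Iy _ n] eqv[OF rr _ m] by auto
    with p show "p = ?p" by simp
  qed
qed

end

end

theory Submission
  imports Defs
begin

text \<open>
  Since \<open>s\<close> is \<open>g\<close>-determined, whiskering with \<open>g\<close> identifies 2-cells \<open>r' \<rightarrow> s\<close> with 2-cells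
  \<open>r'g \<rightarrow> sg\<close>, and since \<open>\<epsilon>\<close> is invertible, \<open>\<theta>g = \<psi> \<cdot> \<epsilon>\<close> makes \<open>\<theta> : g\<^sub>#t \<rightarrow> s\<close> and
  \<open>\<psi> : gt \<rightarrow> sg\<close> determine each other.  Whiskering the monad map axioms of \<open>\<theta>\<close> with \<open>g\<close> (which
  loses nothing, taking \<open>r' = 1\<close> and \<open>r' = (g\<^sub>#t)(g\<^sub>#t)\<close>) turns the unit axiom into that of \<open>\<psi>\<close>, and
  the multiplication axiom into that of \<open>\<psi>\<close> precomposed with \<open>\<epsilon>t \<cdot> (g\<^sub>#t)\<epsilon>\<close>, an isomorphism.
\<close>

context two_category
begin

text \<open>Composing with a right inverse of \<open>\<alpha>\<close> recovers each side. This
  serves both to compare the multiplication axioms and to prove injectivity of the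
  bijection.\<close>

lemma is_iso2_cancel_right:
  assumes a: "is_iso2 K f f' \<alpha>" and b: "\<beta> \<in> hom2 K f' k" "\<beta>' \<in> hom2 K f' k"
    and eq: "\<beta> \<cdot> \<alpha> = \<beta>' \<cdot> \<alpha>"
  shows "\<beta> = \<beta>'"
proof -
  obtain \<alpha>' where "\<alpha> \<in> hom2 K f f'" "\<alpha>' \<in> hom2 K f' f" "\<alpha> \<cdot> \<alpha>' = \<iota> f'"
    using a by (auto simp: is_iso2_def)
  then have "\<gamma> = (\<gamma> \<cdot> \<alpha>) \<cdot> \<alpha>'" if "\<gamma> \<in> hom2 K f' k" for \<gamma>
    using that vcomp_assoc vcomp_id_right by simp
  with b eq show ?thesis by metis
qed

text \<open>Whiskering is functorial, so it sends an inverse to an inverse. With its left-handed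
  twin below, it makes both whiskerings of the counit in the multiplication law of the pushforward
  invertible.\<close>

lemma is_iso2_whisker_right:
  assumes f: "f \<in> hom1 K x y" and k: "k \<in> hom1 K y z" and b: "is_iso2 K k k' \<beta>"
  shows "is_iso2 K (k \<odot> f) (k' \<odot> f) (\<beta> \<star> \<iota> f)"
proof -
  obtain \<beta>' where b: "\<beta> \<in> hom2 K k k'" "\<beta>' \<in> hom2 K k' k"
    and inv: "\<beta>' \<cdot> \<beta> = \<iota> k" "\<beta> \<cdot> \<beta>' = \<iota> k'"
    using b by (auto simp: is_iso2_def)
  have k': "k' \<in> hom1 K y z" using hom2_cod_hom1[OF b(1) k] .
  have "(\<beta>' \<star> \<iota> f) \<cdot> (\<beta> \<star> \<iota> f) = \<iota> (k \<odot> f)" "(\<beta> \<star> \<iota> f) \<cdot> (\<beta>' \<star> \<iota> f) = \<iota> (k' \<odot> f)"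
    using whisker_right_vcomp[OF f k b] whisker_right_vcomp[OF f k' b(2,1)] inv
      hcomp_id2[OF f k] hcomp_id2[OF f k'] by auto
  then show ?thesis
    using hcomp_hom[OF f k id2_hom1[OF f] b(1)] hcomp_hom[OF f k' id2_hom1[OF f] b(2)]
    by (auto simp: is_iso2_def)
qed

lemma is_iso2_whisker_left:
  assumes f: "f \<in> hom1 K x y" and k: "k \<in> hom1 K y z" and a: "is_iso2 K f f' \<alpha>"
  shows "is_iso2 K (k \<odot> f) (k \<odot> f') (\<iota> k \<star> \<alpha>)"
proof -
  obtain \<alpha>' where a: "\<alpha> \<in> hom2 K f f'" "\<alpha>' \<in> hom2 K f' f"
    and inv: "\<alpha>' \<cdot> \<alpha> = \<iota> f" "\<alpha> \<cdot> \<alpha>' = \<iota> f'"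
    using a by (auto simp: is_iso2_def)
  have f': "f' \<in> hom1 K x y" using hom2_cod_hom1[OF a(1) f] .
  have "(\<iota> k \<star> \<alpha>') \<cdot> (\<iota> k \<star> \<alpha>) = \<iota> (k \<odot> f)" "(\<iota> k \<star> \<alpha>) \<cdot> (\<iota> k \<star> \<alpha>') = \<iota> (k \<odot> f')"
    using whisker_left_vcomp[OF f k a] whisker_left_vcomp[OF f' k a(2,1)] inv
      hcomp_id2[OF f k] hcomp_id2[OF f' k] by auto
  then show ?thesis
    using hcomp_hom[OF f k a(1) id2_hom1[OF k]] hcomp_hom[OF f' k a(2) id2_hom1[OF k]]
    by (auto simp: is_iso2_def)
qed

text \<open>The counit of this right extension is an identity, so the factorisation condition
  reduces to \<open>\<theta> \<star> \<iota> g = \<alpha>\<close>.\<close>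

lemma determined_ex1:
  assumes d: "determined K x y z g h" and r: "r \<in> hom1 K y z" and a: "\<alpha> \<in> hom2 K (r \<odot> g) (h \<odot> g)"
  shows "\<exists>!\<theta>. \<theta> \<in> hom2 K r h \<and> \<theta> \<star> \<iota> g = \<alpha>"
proof -
  have g: "g \<in> hom1 K x y"
    and ex: "\<exists>!\<theta>. \<theta> \<in> hom2 K r h \<and> \<iota> (h \<odot> g) \<cdot> (\<theta> \<star> \<iota> g) = \<alpha>"
    using d r a by (auto simp: determined_def is_right_extension_def)
  have "\<iota> (h \<odot> g) \<cdot> (\<theta> \<star> \<iota> g) = \<theta> \<star> \<iota> g" if "\<theta> \<in> hom2 K r h" for \<theta>
    using vcomp_id_left[OF hcomp_hom[OF g r id2_hom1[OF g] that]] .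
  with ex show ?thesis by metis
qed

lemma determined_eq_iff:
  assumes d: "determined K x y z g h" and r: "r \<in> hom1 K y z"
    and th: "\<theta> \<in> hom2 K r h" "\<theta>' \<in> hom2 K r h"
  shows "\<theta> \<star> \<iota> g = \<theta>' \<star> \<iota> g \<longleftrightarrow> \<theta> = \<theta>'"
proof -
  have g: "g \<in> hom1 K x y" using d by (simp add: determined_def is_right_extension_def)
  show ?thesis
    using determined_ex1[OF d r hcomp_hom[OF g r id2_hom1[OF g] th(2)]] th by metis
qed

text \<open>Relating \<open>\<theta>\<close> and \<open>\<psi>\<close> only by the equation
  \<open>eq\<close> lets one equivalence serve twice: left to right, the bijection lands in monad
  maps; right to left, it is surjective.\<close>

lemma Colax_iff_Mnd:
  assumes g: "g \<in> hom1 K x y" and t: "is_monad K x t" and s: "is_monad K y s"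
    and d: "determined K x y y g (mcell s)"
    and p: "is_pushforward K x y g t p \<epsilon>"
    and iso: "is_iso2 K (mcell p \<odot> g) (g \<odot> mcell t) \<epsilon>"
    and th: "\<theta> \<in> hom2 K (mcell p) (mcell s)"
    and ps: "\<psi> \<in> hom2 K (g \<odot> mcell t) (mcell s \<odot> g)"
    and eq: "\<theta> \<star> \<iota> g = \<psi> \<cdot> \<epsilon>"
  shows "(g, \<psi>) \<in> Colax K g t s \<longleftrightarrow> \<theta> \<in> Mnd K p s"
proof -
  define T P S where "T = mcell t" and "P = mcell p" and "S = mcell s"
  have T: "T \<in> hom1 K x x" and et: "munit t \<in> hom2 K (\<one> x) T"
    and mt: "mmult t \<in> hom2 K (T \<odot> T) T" and x: "x \<in> Obj K"
    using t by (auto simp: is_monad_def T_def)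
  have S: "S \<in> hom1 K y y" and es: "munit s \<in> hom2 K (\<one> y) S"
    and ms: "mmult s \<in> hom2 K (S \<odot> S) S" and y: "y \<in> Obj K"
    using s by (auto simp: is_monad_def S_def)
  have P: "P \<in> hom1 K y y" and ep: "munit p \<in> hom2 K (\<one> y) P"
    and mp: "mmult p \<in> hom2 K (P \<odot> P) P"
    and E: "\<epsilon> \<in> hom2 K (P \<odot> g) (g \<odot> T)"
    and pe: "\<epsilon> \<cdot> (munit p \<star> \<iota> g) = \<iota> g \<star> munit t"
    and pm: "\<epsilon> \<cdot> (mmult p \<star> \<iota> g) = (\<iota> g \<star> mmult t) \<cdot> (\<epsilon> \<star> \<iota> T) \<cdot> (\<iota> P \<star> \<epsilon>)"
    using p by (auto simp: is_pushforward_def is_monad_def is_right_extension_def P_def T_def)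
  note iso = iso[folded P_def T_def] and d = d[folded S_def]
    and th = th[folded P_def S_def] and ps = ps[folded S_def T_def]
  note c1 = comp1_hom and i = id2_hom1 and Iy = id1_hom[OF y]
  have gT: "g \<odot> T \<in> hom1 K x y" and Pg: "P \<odot> g \<in> hom1 K x y" and PP: "P \<odot> P \<in> hom1 K y y"
    and Sg: "S \<odot> g \<in> hom1 K x y" and TT: "T \<odot> T \<in> hom1 K x x"
    using g T P S c1 by blast+

  have "(\<theta> \<cdot> munit p) \<star> \<iota> g = (\<psi> \<cdot> \<epsilon>) \<cdot> (munit p \<star> \<iota> g)"
    using whisker_right_vcomp[OF g Iy ep th] eq by simp
  also have "\<dots> = \<psi> \<cdot> (\<iota> g \<star> munit t)"
    using vcomp_assoc[OF hcomp_hom[OF g Iy i[OF g] ep] E ps] pe by simp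
  \<comment> \<open>Determinedness at the 1-cell \<open>\<one> y\<close> removes the whiskering with
    \<open>g\<close>.\<close>
  finally have unit: "\<psi> \<cdot> (\<iota> g \<star> munit t) = munit s \<star> \<iota> g \<longleftrightarrow> \<theta> \<cdot> munit p = munit s"
    using determined_eq_iff[OF d Iy vcomp_hom[OF ep th] es] by simp

  have PE: "\<iota> P \<star> \<epsilon> \<in> hom2 K (P \<odot> P \<odot> g) (P \<odot> g \<odot> T)"
    using hcomp_hom[OF Pg P E i[OF P]] .
  have ET: "\<epsilon> \<star> \<iota> T \<in> hom2 K (P \<odot> g \<odot> T) (g \<odot> T \<odot> T)"
    using hcomp_hom[OF T Pg i[OF T] E] comp1_assoc[OF T g P] comp1_assoc[OF T T g] by simp
  have gm: "\<iota> g \<star> mmult t \<in> hom2 K (g \<odot> T \<odot> T) (g \<odot> T)"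
    using hcomp_hom[OF TT g mt i[OF g]] .
  have pT: "\<psi> \<star> \<iota> T \<in> hom2 K (g \<odot> T \<odot> T) (S \<odot> g \<odot> T)"
    using hcomp_hom[OF T gT i[OF T] ps] comp1_assoc[OF T g S] comp1_assoc[OF T T g] by simp
  have Sp: "\<iota> S \<star> \<psi> \<in> hom2 K (S \<odot> g \<odot> T) (S \<odot> S \<odot> g)"
    using hcomp_hom[OF gT S ps i[OF S]] .
  have mg: "mmult s \<star> \<iota> g \<in> hom2 K (S \<odot> S \<odot> g) (S \<odot> g)"
    using hcomp_hom[OF g c1[OF S S] i[OF g] ms] comp1_assoc[OF g S S] by simp
  have mpg: "mmult p \<star> \<iota> g \<in> hom2 K (P \<odot> P \<odot> g) (P \<odot> g)"
    using hcomp_hom[OF g PP i[OF g] mp] comp1_assoc[OF g P P] by simp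
  have thth: "\<theta> \<star> \<theta> \<in> hom2 K (P \<odot> P) (S \<odot> S)"
    using hcomp_hom[OF P P th th] .
  let ?L = "\<psi> \<cdot> (\<iota> g \<star> mmult t)"
    and ?R = "(mmult s \<star> \<iota> g) \<cdot> (\<iota> S \<star> \<psi>) \<cdot> (\<psi> \<star> \<iota> T)"
  have L: "?L \<in> hom2 K (g \<odot> T \<odot> T) (S \<odot> g)" using vcomp_hom[OF gm ps] .
  have R: "?R \<in> hom2 K (g \<odot> T \<odot> T) (S \<odot> g)"
    using vcomp_hom[OF vcomp_hom[OF pT Sp] mg] .

  have "(\<theta> \<cdot> mmult p) \<star> \<iota> g = (\<psi> \<cdot> \<epsilon>) \<cdot> (mmult p \<star> \<iota> g)"
    using whisker_right_vcomp[OF g PP mp th] eq by simp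
  also have "\<dots> = \<psi> \<cdot> (\<iota> g \<star> mmult t) \<cdot> (\<epsilon> \<star> \<iota> T) \<cdot> (\<iota> P \<star> \<epsilon>)"
    using vcomp_assoc[OF mpg E ps] pm by simp
  also have "\<dots> = (?L \<cdot> (\<epsilon> \<star> \<iota> T)) \<cdot> (\<iota> P \<star> \<epsilon>)"
    using vcomp_assoc[OF vcomp_hom[OF PE ET] gm ps] vcomp_assoc[OF PE ET L] by simp
  finally have lhs: "(\<theta> \<cdot> mmult p) \<star> \<iota> g = (?L \<cdot> (\<epsilon> \<star> \<iota> T)) \<cdot> (\<iota> P \<star> \<epsilon>)" .

  \<comment> \<open>Here \<open>eq\<close> rewrites the inner factor
    \<open>\<theta> \<star> \<iota> g\<close>; padding the outer \<open>\<theta>\<close> with an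
    identity prepares the interchange law.\<close>
  have "(\<theta> \<star> \<theta>) \<star> \<iota> g = (\<iota> S \<cdot> \<theta>) \<star> (\<psi> \<cdot> \<epsilon>)"
    using hcomp_assoc[OF g P P i[OF g] th th] eq vcomp_id_left[OF th] by simp
  also have "\<dots> = (\<iota> S \<star> \<psi>) \<cdot> (\<theta> \<star> \<epsilon>)"
    using interchange[OF Pg P E ps th i[OF S]] .
  \<comment> \<open>Of the two ways to split this composite, this one applies the whiskered counit
    first, as in \<open>lhs\<close>, and leaves a whiskering of \<open>\<theta>\<close> to which
    \<open>eq\<close> applies again.\<close>
  also have "\<theta> \<star> \<epsilon> = (\<theta> \<star> \<iota> (g \<odot> T)) \<cdot> (\<iota> P \<star> \<epsilon>)"
    using interchange[OF Pg P E i[OF gT] i[OF P] th] vcomp_id_left[OF E] vcomp_id_right[OF th]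
    by simp
  also have "\<theta> \<star> \<iota> (g \<odot> T) = (\<theta> \<star> \<iota> g) \<star> \<iota> T"
    using hcomp_assoc[OF T g P i[OF T] i[OF g] th] hcomp_id2[OF T g] by simp
  also have "\<dots> = (\<psi> \<star> \<iota> T) \<cdot> (\<epsilon> \<star> \<iota> T)"
    using whisker_right_vcomp[OF T Pg E ps] eq by simp
  finally have "(\<theta> \<star> \<theta>) \<star> \<iota> g = (\<iota> S \<star> \<psi>) \<cdot> ((\<psi> \<star> \<iota> T) \<cdot> (\<epsilon> \<star> \<iota> T)) \<cdot> (\<iota> P \<star> \<epsilon>)" .
  also have "\<dots> = (((\<iota> S \<star> \<psi>) \<cdot> (\<psi> \<star> \<iota> T)) \<cdot> (\<epsilon> \<star> \<iota> T)) \<cdot> (\<iota> P \<star> \<epsilon>)"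
    using vcomp_assoc[OF PE vcomp_hom[OF ET pT] Sp] vcomp_assoc[OF ET pT Sp] by simp
  finally have "(mmult s \<cdot> (\<theta> \<star> \<theta>)) \<star> \<iota> g =
      (mmult s \<star> \<iota> g) \<cdot> (((\<iota> S \<star> \<psi>) \<cdot> (\<psi> \<star> \<iota> T)) \<cdot> (\<epsilon> \<star> \<iota> T)) \<cdot> (\<iota> P \<star> \<epsilon>)"
    using whisker_right_vcomp[OF g PP thth ms] by simp
  also have "\<dots> = (?R \<cdot> (\<epsilon> \<star> \<iota> T)) \<cdot> (\<iota> P \<star> \<epsilon>)"
    using vcomp_assoc[OF PE vcomp_hom[OF ET vcomp_hom[OF pT Sp]] mg]
      vcomp_assoc[OF ET vcomp_hom[OF pT Sp] mg] by simp
  finally have rhs: "(mmult s \<cdot> (\<theta> \<star> \<theta>)) \<star> \<iota> g = (?R \<cdot> (\<epsilon> \<star> \<iota> T)) \<cdot> (\<iota> P \<star> \<epsilon>)" .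

  have isoP: "is_iso2 K (P \<odot> P \<odot> g) (P \<odot> g \<odot> T) (\<iota> P \<star> \<epsilon>)"
    using is_iso2_whisker_left[OF Pg P iso] .
  have isoT: "is_iso2 K (P \<odot> g \<odot> T) (g \<odot> T \<odot> T) (\<epsilon> \<star> \<iota> T)"
    using is_iso2_whisker_right[OF T Pg iso] comp1_assoc[OF T g P] comp1_assoc[OF T T g] by simp
  have "\<theta> \<cdot> mmult p = mmult s \<cdot> (\<theta> \<star> \<theta>) \<longleftrightarrow>
      (?L \<cdot> (\<epsilon> \<star> \<iota> T)) \<cdot> (\<iota> P \<star> \<epsilon>) = (?R \<cdot> (\<epsilon> \<star> \<iota> T)) \<cdot> (\<iota> P \<star> \<epsilon>)"
    using determined_eq_iff[OF d PP vcomp_hom[OF mp th] vcomp_hom[OF thth ms]] lhs rhs by simp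
  \<comment> \<open>The two invertible factors are cancelled one at a time,
    \<open>\<iota> P \<star> \<epsilon>\<close> first and then
    \<open>\<epsilon> \<star> \<iota> T\<close>.\<close>
  also have "\<dots> \<longleftrightarrow> ?L = ?R"
    using is_iso2_cancel_right[OF isoP vcomp_hom[OF ET L] vcomp_hom[OF ET R]]
      is_iso2_cancel_right[OF isoT L R] by auto
  finally show ?thesis
    using unit th ps by (auto simp: Colax_def Mnd_def S_def P_def T_def)
qed

end

theorem corollary1p17:
  fixes K :: "('o, 'm, 'c, 'e) two_cat_scheme" (structure)
    and x y :: 'o
    and g :: 'm
    and t s p :: "('m, 'c) monad"
    and \<epsilon> :: 'c
  assumes "two_category K"
    and "g \<in> hom1 K x y"
    and "is_monad K x t"
    and "is_monad K y s"
    and "determined K x y y g (mcell s)"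
    and "is_pushforward K x y g t p \<epsilon>"
    and "is_iso2 K (mcell p \<odot> g) (g \<odot> mcell t) \<epsilon>"
  shows "(\<forall>(h, \<psi>) \<in> Colax K g t s.
            \<exists>!\<theta>. \<theta> \<in> hom2 K (mcell p) (mcell s) \<and> \<theta> \<star> \<iota> g = \<psi> \<cdot> \<epsilon>)
       \<and> bij_betw
            (\<lambda>(h, \<psi>). THE \<theta>. \<theta> \<in> hom2 K (mcell p) (mcell s) \<and> \<theta> \<star> \<iota> g = \<psi> \<cdot> \<epsilon>)
            (Colax K g t s) (Mnd K p s)"
proof -
  interpret two_category K by fact
  note g = assms(2) and d = assms(5) and iso = assms(7) and key = Colax_iff_Mnd[OF assms(2-7)]
  have P: "mcell p \<in> hom1 K y y"
    using assms(6) by (simp add: is_pushforward_def is_monad_def)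
  obtain \<delta> where E: "\<epsilon> \<in> hom2 K (mcell p \<odot> g) (g \<odot> mcell t)"
    and D: "\<delta> \<in> hom2 K (g \<odot> mcell t) (mcell p \<odot> g)" and DE: "\<delta> \<cdot> \<epsilon> = \<iota> (mcell p \<odot> g)"
    using iso by (auto simp: is_iso2_def)
  let ?Q = "\<lambda>\<psi> \<theta>. \<theta> \<in> hom2 K (mcell p) (mcell s) \<and> \<theta> \<star> \<iota> g = \<psi> \<cdot> \<epsilon>"
  define F where "F = (\<lambda>(h :: 'm, \<psi>). THE \<theta>. ?Q \<psi> \<theta>)"
  have colax: "h = g \<and> \<psi> \<in> hom2 K (g \<odot> mcell t) (mcell s \<odot> g)"
    if "(h, \<psi>) \<in> Colax K g t s" for h \<psi>
    using that by (auto simp: Colax_def)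
  have ex1: "\<exists>!\<theta>. ?Q \<psi> \<theta>" if "(h, \<psi>) \<in> Colax K g t s" for h \<psi>
    using determined_ex1[OF d P vcomp_hom[OF E]] colax[OF that] by blast
  have F_whisker: "?Q \<psi> (F (h, \<psi>))" if "(h, \<psi>) \<in> Colax K g t s" for h \<psi>
    using theI'[OF ex1[OF that]] by (simp add: F_def)
  have "bij_betw F (Colax K g t s) (Mnd K p s)"
  proof (rule bij_betwI')
    fix a b
    assume ab: "a \<in> Colax K g t s" "b \<in> Colax K g t s"
    obtain h \<psi> h' \<psi>' where a: "a = (h, \<psi>)" and b: "b = (h', \<psi>')" by fastforce
    \<comment> \<open>Equal images have equal whiskerings with \<open>g\<close>, so
      \<open>\<psi>\<close> and \<open>\<psi>'\<close> agree after precomposition with the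
      isomorphism \<open>\<epsilon>\<close>. The first components are both \<open>g\<close>.\<close>
    have "\<psi> = \<psi>'" if "F a = F b"
    proof (rule is_iso2_cancel_right[OF iso])
      show "\<psi> \<cdot> \<epsilon> = \<psi>' \<cdot> \<epsilon>" using F_whisker[of h \<psi>] F_whisker[of h' \<psi>'] ab that a b by simp
    qed (use ab a b colax in blast)+
    then show "F a = F b \<longleftrightarrow> a = b" using ab colax a b by blast
  next
    fix a
    assume A: "a \<in> Colax K g t s"
    obtain h \<psi> where a: "a = (h, \<psi>)" by fastforce
    show "F a \<in> Mnd K p s"
      using key[of "F a" \<psi>] F_whisker[of h \<psi>] colax[of h \<psi>] A a by auto
  next
    fix \<theta>
    assume A: "\<theta> \<in> Mnd K p s"
    then have th: "\<theta> \<in> hom2 K (mcell p) (mcell s)" by (simp add: Mnd_def)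
    have thg: "\<theta> \<star> \<iota> g \<in> hom2 K (mcell p \<odot> g) (mcell s \<odot> g)"
      using hcomp_hom[OF g P id2_hom1[OF g] th] .
    \<comment> \<open>This is the only possible preimage: solving
      \<open>\<theta> \<star> \<iota> g = \<psi> \<cdot> \<epsilon>\<close> for
      \<open>\<psi>\<close> means composing with the inverse \<open>\<delta>\<close>.\<close>
    define \<psi> where "\<psi> = (\<theta> \<star> \<iota> g) \<cdot> \<delta>"
    have ps: "\<psi> \<in> hom2 K (g \<odot> mcell t) (mcell s \<odot> g)"
      using vcomp_hom[OF D thg] by (simp add: \<psi>_def)
    have eq: "\<theta> \<star> \<iota> g = \<psi> \<cdot> \<epsilon>"
      using vcomp_assoc[OF E D thg] DE vcomp_id_right[OF thg] by (simp add: \<psi>_def)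
    have c: "(g, \<psi>) \<in> Colax K g t s" using key[OF th ps eq] A by simp
    \<comment> \<open>Both 2-cells whisker to \<open>\<psi> \<cdot> \<epsilon>\<close>, so
      uniqueness in \<open>ex1\<close> identifies them.\<close>
    have "\<theta> = F (g, \<psi>)" using ex1[OF c] F_whisker[OF c] th eq by blast
    with c show "\<exists>a \<in> Colax K g t s. \<theta> = F a" by blast
  qed
  with ex1 show ?thesis unfolding F_def by blast
qed

end
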